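(* For any composite number $n > 0$, there exist a set $\mathcal{A}$ and a set $\mathcal{B}$ of nonnegative integers such that $|\mathcal{A}| = n$, $\mathcal{B}$ is an additive complement of $\mathcal{A}$, $\mathcal{A}$ is not of the form \[ \mathcal{A} = \{a + i n^{s} + k_{i} n^{s+1} : i = 0, \dots, n-1\}, \] where $s \ge 0$, $a > 0$ and $k_{i}$ ($0 \le i \le n-1$) are integers (that is, there are no integers $a>0$, $s\ge 0$, $k_0,\dots,k_{n-1}$ for which this equality holds), and \[ A(x)B(x) - x = O(1) \quad \text{as } x \to +\infty . \]
   Context: For sets $\mathcal{A}$, $\mathcal{B}$ of nonnegative integers, the counting functions are $A(x) = |\{a \in \mathcal{A} : a \le x\}|$ and $B(x) = |\{b \in \mathcal{B} : b \le x\}|$. A set $\mathcal{B}$ of nonnegative integers is an additive complement of $\mathcal{A}$ if every sufficiently large positive integer $m$ can be represented in the form $m = a + b$ with $a \in \mathcal{A}$, $b \in \mathcal{B}$. The integers $k_i$ may be negative. *)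

theory Defs
  imports
    Complex_Main
    "HOL-Computational_Algebra.Primes"
    "HOL-Library.Landau_Symbols"
begin

definition composite :: "nat \<Rightarrow> bool" where
  "composite n \<longleftrightarrow> n > 1 \<and> \<not> prime n"

definition counting :: "nat set \<Rightarrow> real \<Rightarrow> nat" where
  "counting S x = card {a \<in> S. real a \<le> x}"

definition additive_complement :: "nat set \<Rightarrow> nat set \<Rightarrow> bool" where
  "additive_complement A B \<longleftrightarrow>
     (\<forall>\<^sub>F m in sequentially. \<exists>a\<in>A. \<exists>b\<in>B. m = a + b)"

end

theory Submission
  imports Defs
begin

text \<open>
  Write a composite number as \<^term>\<open>n = u * v\<close> with \<open>u, v > 1\<close>. Every natural number has a unique
  mixed-radix expansion \<open>i + u * (r + v * (j + v * q))\<close> with digits \<open>i < u\<close>, \<open>r < v\<close>, \<open>j < v\<close> and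
  arbitrary \<open>q\<close>. Give the digits \<open>i, j\<close> to \<open>A\<close> and the digits \<open>r, q\<close> to \<open>B\<close>: the elements of
  \<open>A\<close> are the \<open>n\<close> numbers \<open>i + n * j\<close>, and each natural number is the sum of exactly one element
  of \<open>A\<close> and one of \<open>B\<close>.

  Such an exact tiling has \<open>A(x) * B(x) = x + O(1)\<close>, because the sums \<open>a + b\<close> with \<open>b \<le> x\<close> are
  distinct, cover \<open>[0, x]\<close>, and never exceed \<open>x + max A\<close>.

  A set of the excluded form has all its differences divisible by \<open>n ^ s\<close>, and its elements are
  distinct modulo \<open>n ^ (s + 1)\<close>. But \<open>0, 1 \<in> A\<close> because \<open>u > 1\<close>, which forces \<open>s = 0\<close>, and
  \<open>0, n \<in> A\<close> because \<open>v > 1\<close>, which is a collision modulo \<open>n\<close>.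
\<close>

text \<open>
  The difference \<open>1\<close> between the first two elements rules out \<open>s > 0\<close>, and the difference \<open>n\<close>
  between the first and the third contradicts distinctness modulo \<open>n\<close>, which the form
  requires when \<open>s = 0\<close>.
\<close>

lemma not_residue_form:
  fixes S :: "int set" and n :: nat and k :: "nat \<Rightarrow> int"
  assumes "n > 1" and "x \<in> S" "x + 1 \<in> S" "x + int n \<in> S"
  shows "S \<noteq> {a + int i * int n ^ s + k i * int n ^ (s + 1) | i. i \<in> {0..n - 1}}"
proof
  assume S: "S = {a + int i * int n ^ s + k i * int n ^ (s + 1) | i. i \<in> {0..n - 1}}"
  obtain i where i: "i \<le> n - 1" "x = a + int i * int n ^ s + k i * int n ^ (s + 1)"
    using assms(2) S by auto
  obtain i' where i': "x + 1 = a + int i' * int n ^ s + k i' * int n ^ (s + 1)"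
    using assms(3) S by auto
  obtain j where j: "j \<le> n - 1" "x + int n = a + int j * int n ^ s + k j * int n ^ (s + 1)"
    using assms(4) S by auto
  have "1 = int n ^ s * (int i' - int i + (k i' - k i) * int n)"
    using i(2) i' by (simp add: algebra_simps)
  then have "int n ^ s dvd 1"
    by (rule dvdI)
  then have "s = 0"
    using \<open>n > 1\<close> is_unit_power_iff[of "int n" s] by auto
  then have "int j - int i = int n * (1 - k j + k i)"
    using i(2) j(2) by (simp add: algebra_simps)
  then have "int n dvd int j - int i"
    by (rule dvdI)
  moreover have "\<bar>int j - int i\<bar> < int n"
    using i(1) j(1) \<open>n > 1\<close> by linarith
  ultimately have "i = j"
    using dvd_imp_le_int[of "int j - int i" "int n"] by auto
  then show False
    using i(2) j(2) \<open>n > 1\<close> by simp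
qed

lemma additive_complement_if_tiling:
  assumes "bij_betw (\<lambda>(a, b). a + b) (A \<times> B) UNIV"
  shows "additive_complement A B"
proof -
  have "\<exists>a\<in>A. \<exists>b\<in>B. m = a + b" for m
    using bij_betw_imp_surj_on[OF assms] by (auto simp: set_eq_iff image_iff)
  then show ?thesis
    unfolding additive_complement_def by simp
qed

text \<open>
  Once \<open>x \<ge> max A\<close>, the product \<open>A(x) * B(x)\<close> is the number of pairs in \<open>A \<times> B\<close> whose second
  entry is at most \<open>x\<close>. Addition maps these pairs injectively onto a set that lies between
  \<open>{0..x}\<close> and \<open>{0..x + max A}\<close>.
\<close>

lemma counting_product_if_tiling:
  assumes bij: "bij_betw (\<lambda>(a, b). a + b) (A \<times> B) (UNIV :: nat set)" and "finite A"
  shows "(\<lambda>x::real. real (counting A x) * real (counting B x) - x) \<in> O[at_top](\<lambda>_. 1)"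
proof -
  obtain M where M: "\<And>a. a \<in> A \<Longrightarrow> a \<le> M"
    using \<open>finite A\<close> finite_nat_set_iff_bounded_le by auto
  have "\<bar>real (counting A x) * real (counting B x) - x\<bar> \<le> real M + 1"
    if x: "x \<ge> real M" for x :: real
  proof -
    define N where "N = nat \<lfloor>x\<rfloor>"
    have le_N: "real b \<le> x \<longleftrightarrow> b \<le> N" for b
      unfolding N_def using x by (auto simp: le_nat_floor) linarith+
    have N: "real N \<le> x" "x < real N + 1"
      using x unfolding N_def by linarith+
    define B' where "B' = {b \<in> B. b \<le> N}"
    define T where "T = (\<lambda>(a, b). a + b) ` (A \<times> B')"
    have "counting A x = card A"
      using M x unfolding counting_def by (intro arg_cong[where f = card]) force
    moreover have "counting B x = card B'"
      unfolding counting_def B'_def le_N ..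
    moreover have "inj_on (\<lambda>(a, b). a + b) (A \<times> B')"
      by (rule inj_on_subset[OF bij_betw_imp_inj_on[OF bij]]) (auto simp: B'_def)
    then have "card T = card A * card B'"
      unfolding T_def by (simp add: card_image card_cartesian_product)
    ultimately have card_T: "real (counting A x) * real (counting B x) = real (card T)"
      by simp
    have "{..N} \<subseteq> T"
    proof
      fix m assume "m \<in> {..N}"
      moreover have "m \<in> (\<lambda>(a, b). a + b) ` (A \<times> B)"
        using bij_betw_imp_surj_on[OF bij] by simp
      then obtain a b where "a \<in> A" "b \<in> B" "m = a + b"
        by auto
      ultimately show "m \<in> T"
        unfolding T_def B'_def by force
    qed
    moreover have upper: "T \<subseteq> {..N + M}"
      using M unfolding T_def B'_def by (force intro: add_mono simp: add.commute)
    then have "finite T"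
      using finite_subset by blast
    ultimately have "N + 1 \<le> card T"
      using card_mono[of T "{..N}"] by simp
    moreover have "card T \<le> N + M + 1"
      using card_mono[OF _ upper] by simp
    ultimately show ?thesis
      unfolding card_T using N by linarith
  qed
  then show ?thesis
    by (intro bigoI[where c = "real M + 1"] eventually_at_top_linorderI[of "real M"]) simp
qed

lemma digit_unique:
  fixes i t i' t' u :: nat
  assumes "i + u * t = i' + u * t'" "i < u" "i' < u"
  shows "i = i'" "t = t'"
proof -
  show "i = i'"
    using arg_cong[OF assms(1), where f = "\<lambda>m. m mod u"] assms(2,3) by simp
  then show "t = t'"
    using assms by simp
qed

text \<open>
  Alternating the digits of the mixed-radix expansion with radices \<open>u, v, v\<close> between the
  two summands gives a tiling of the natural numbers.
\<close>

lemma mixed_radix_tiling: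
  fixes u v :: nat
  assumes "u > 0" "v > 0"
  defines "A \<equiv> (\<lambda>(i, j). i + u * v * j) ` ({..<u} \<times> {..<v})"
    and "B \<equiv> (\<lambda>(r, q). u * r + u * v * v * q) ` ({..<v} \<times> UNIV)"
  shows "bij_betw (\<lambda>(a, b). a + b) (A \<times> B) UNIV"
proof (rule bij_betwI')
  fix p p' assume "p \<in> A \<times> B" "p' \<in> A \<times> B"
  then obtain i j r q i' j' r' q' where
    p: "p = (i + u * v * j, u * r + u * v * v * q)" "i < u" "j < v" "r < v" and
    p': "p' = (i' + u * v * j', u * r' + u * v * v * q')" "i' < u" "j' < v" "r' < v"
    unfolding A_def B_def by auto
  show "(case p of (a, b) \<Rightarrow> a + b) = (case p' of (a, b) \<Rightarrow> a + b) \<longleftrightarrow> p = p'"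
  proof
    assume "(case p of (a, b) \<Rightarrow> a + b) = (case p' of (a, b) \<Rightarrow> a + b)"
    then have *: "i + u * (r + v * (j + v * q)) = i' + u * (r' + v * (j' + v * q'))"
      unfolding p(1) p'(1) by (simp add: algebra_simps)
    note 1 = digit_unique[OF * p(2) p'(2)]
    note 2 = digit_unique[OF 1(2) p(4) p'(4)]
    note 3 = digit_unique[OF 2(2) p(3) p'(3)]
    show "p = p'"
      unfolding p(1) p'(1) using 1(1) 2(1) 3 by simp
  qed simp
next
  fix m :: nat
  define t where "t = m div u"
  define w where "w = t div v"
  have "m = m mod u + u * (t mod v + v * (w mod v + v * (w div v)))"
    unfolding t_def w_def by simp
  also have "\<dots> = (m mod u + u * v * (w mod v)) + (u * (t mod v) + u * v * v * (w div v))"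
    by (simp only: algebra_simps)
  finally have "m = (m mod u + u * v * (w mod v)) + (u * (t mod v) + u * v * v * (w div v))" .
  moreover have "m mod u + u * v * (w mod v) \<in> A"
    unfolding A_def using assms(1,2) by force
  moreover have "u * (t mod v) + u * v * v * (w div v) \<in> B"
    unfolding B_def using assms(2) by force
  ultimately show "\<exists>p\<in>A \<times> B. m = (case p of (a, b) \<Rightarrow> a + b)"
    by (intro bexI[of _ "(m mod u + u * v * (w mod v), u * (t mod v) + u * v * v * (w div v))"]) auto
qed simp

theorem theorem2:
  fixes n :: nat
  assumes "composite n"
  shows "\<exists>A B :: nat set.
    finite A \<and> card A = n \<and>
    additive_complement A B \<and>
    \<not> (\<exists>(a::int) (s::nat) (k::nat \<Rightarrow> int). a > 0 \<and>
         int ` A = {a + int i * int n ^ s + k i * int n ^ (s + 1) | i. i \<in> {0..n - 1}}) \<and>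
    (\<lambda>x::real. real (counting A x) * real (counting B x) - x) \<in> O[at_top](\<lambda>_. 1)"
proof -
  have "n > 1" "\<not> prime n"
    using assms unfolding composite_def by auto
  then obtain u v where n: "n = u * v" and "u \<noteq> 1" "v \<noteq> 1"
    by (auto simp: prime_nat_iff dvd_def)
  then have "u > 1" "v > 1"
    using \<open>n > 1\<close> by (cases u; cases v; auto)+
  define A where "A = (\<lambda>(i, j). i + u * v * j) ` ({..<u} \<times> {..<v})"
  define B where "B = (\<lambda>(r, q). u * r + u * v * v * q) ` ({..<v} \<times> (UNIV :: nat set))"
  have tiling: "bij_betw (\<lambda>(a, b). a + b) (A \<times> B) UNIV"
    unfolding A_def B_def using \<open>u > 1\<close> \<open>v > 1\<close> by (intro mixed_radix_tiling) auto
  have "finite A"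
    unfolding A_def by simp
  have "inj_on (\<lambda>(i, j). i + u * v * j) ({..<u} \<times> {..<v})"
  proof (rule inj_onI, clarsimp)
    fix i j i' j' assume eq: "i + u * v * j = i' + u * v * j'" and "i < u" "i' < u"
    moreover have "u \<le> u * v"
      using \<open>v > 1\<close> by simp
    ultimately have "i < u * v" "i' < u * v"
      by linarith+
    then show "i = i' \<and> j = j'"
      using digit_unique[OF eq] by blast
  qed
  then have "card A = n"
    unfolding A_def n by (simp add: card_image card_cartesian_product)
  have "0 \<in> A" "1 \<in> A" "n \<in> A"
    using \<open>u > 1\<close> \<open>v > 1\<close> unfolding A_def n
    by (force intro: image_eqI[where x = "(0, 0)"] image_eqI[where x = "(1, 0)"]
        image_eqI[where x = "(0, 1)"])+
  then have int_A: "0 \<in> int ` A" "0 + 1 \<in> int ` A" "0 + int n \<in> int ` A"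
    by (auto intro: image_eqI[where x = 0] image_eqI[where x = 1])
  have "\<not> (\<exists>(a::int) (s::nat) (k::nat \<Rightarrow> int). a > 0 \<and>
      int ` A = {a + int i * int n ^ s + k i * int n ^ (s + 1) | i. i \<in> {0..n - 1}})"
    using not_residue_form[OF \<open>n > 1\<close> int_A] by iprover
  then show ?thesis
    using \<open>finite A\<close> \<open>card A = n\<close> additive_complement_if_tiling[OF tiling]
      counting_product_if_tiling[OF tiling \<open>finite A\<close>]
    by (intro exI[of _ A] exI[of _ B] conjI)
qed

end
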